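(* $$\gamma_5' = \frac{1-14^{-1/3}}{1+14^{1/3}}.$$
   Context: $\gamma_5'$ denotes the supremum of $\frac{\lambda_1+\lambda_n}{n}$ over all positive integers $n$ and all real numbers $\lambda_1\geq\dots\geq\lambda_n$ satisfying $\sum_{i=1}^n\lambda_i=0$, $\sum_{i=1}^n\lambda_i^3=0$ and $\sum_{i=1}^n\lambda_i^2\leq n\lambda_1$. *)

theory Defs
  imports Complex_Main
begin

text \<open>The real sequence \<open>\<lambda>\<^sub>1 \<ge> \<dots> \<ge> \<lambda>\<^sub>n\<close> is a function on \<open>nat\<close> of which only the values
  on \<open>{1..n}\<close> matter.\<close>

definition feasible :: "nat \<Rightarrow> (nat \<Rightarrow> real) \<Rightarrow> bool" where
  "feasible n l \<longleftrightarrow>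
     antimono_on {1..n} l \<and>
     (\<Sum>i=1..n. l i) = 0 \<and>
     (\<Sum>i=1..n. l i ^ 3) = 0 \<and>
     (\<Sum>i=1..n. (l i)\<^sup>2) \<le> real n * l 1"

definition gamma5'_values :: "real set" where
  "gamma5'_values = {(l 1 + l n) / real n | n l. n \<ge> 1 \<and> feasible n l}"

definition gamma5' :: real where
  "gamma5' = Sup gamma5'_values"

text \<open>The next two facts show that the real-valued \<^const>\<open>Sup\<close> in \<^const>\<open>gamma5'\<close> is a genuine
  least upper bound.\<close>

lemma gamma5'_values_nonempty: "gamma5'_values \<noteq> {}"
proof -
  have "feasible 1 (\<lambda>_. 0)"
    by (auto simp: feasible_def monotone_on_def)
  then show ?thesis
    unfolding gamma5'_values_def by blast
qed

lemma gamma5'_values_bdd_above: "bdd_above gamma5'_values"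
proof (rule bdd_aboveI[where M = 2])
  fix x assume "x \<in> gamma5'_values"
  then obtain n l where x: "x = (l 1 + l n) / real n" and n: "n \<ge> 1" and f: "feasible n l"
    unfolding gamma5'_values_def by blast
  have "(l 1)\<^sup>2 \<le> (\<Sum>i=1..n. (l i)\<^sup>2)"
    using n by (intro member_le_sum) auto
  also have "\<dots> \<le> real n * l 1"
    using f by (simp add: feasible_def)
  finally have sq: "l 1 * l 1 \<le> real n * l 1"
    by (simp add: power2_eq_square)
  have "l 1 \<le> real n"
  proof (cases "l 1 > 0")
    case True
    with sq show ?thesis by simp
  next
    case False
    then show ?thesis by linarith
  qed
  moreover have "l n \<le> l 1"
    using f n by (auto simp: feasible_def monotone_on_def)
  ultimately have "l 1 + l n \<le> 2 * real n"
    by linarith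
  then show "x \<le> 2"
    using n unfolding x by (simp add: pos_divide_le_eq)
qed

end

theory Submission
  imports Defs
begin

text \<open>
  Dividing the sequence by \<open>n\<close>, one has to maximise \<open>x - y\<close>, where \<open>x\<close> is the largest entry and
  \<open>-y\<close> the smallest, over finite families with \<open>\<Sum>\<mu> = 0\<close>, \<open>\<Sum>\<mu>\<^sup>3 = 0\<close> and \<open>\<Sum>\<mu>\<^sup>2 \<le> x\<close>. The
  condition on \<open>\<Sum>\<mu>\<close> costs nothing in the limit: many tiny entries can carry any sum while
  their squares are negligible. What remains is the balance of cubes against squares.

  For the upper bound only \<open>x > y\<close> matters. Put \<open>t = x / y\<close>, and let \<open>v\<close> be the absolute values of the negative entries
  divided by \<open>y\<close>, so that \<open>0 \<le> v \<le> 1\<close>. With \<open>A = \<Sum>v\<^sup>3\<close> and \<open>M = \<Sum>v\<^sup>2\<close> the cube condition gives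
  \<open>A \<ge> t\<^sup>3\<close> and the square condition gives \<open>x - y \<le> t (t - 1) / (t\<^sup>2 + M)\<close>. Since \<open>M \<ge> A \<ge> t\<^sup>3\<close>, this
  is at most \<open>(t - 1) / (t (t + 1))\<close>, whose maximum over real \<open>t \<ge> 1\<close> lies at \<open>t = 1 + sqrt 2\<close>, where
  \<open>t\<^sup>3 = 7 + 5 * sqrt 2\<close> is about \<open>14.07\<close>. However, \<open>M\<close> is close to \<open>A\<close> only if all \<open>v\<close> are close
  to \<open>0\<close> or \<open>1\<close>, hence only if \<open>A\<close> is close to an integer. Lemma \<open>sum_squares_ge_off_integer\<close>
  quantifies this, and lemma \<open>ratio_le_at_cuberoot_14\<close> shows that the loss moves the
  optimum to \<open>t\<^sup>3 = 14\<close>.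

  For the lower bound, with \<open>a\<^sup>3 = 14\<close>, one entry \<open>a\<close> and \<open>14\<close> entries \<open>-1\<close> have cube sum \<open>0\<close>.
  Their sum \<open>a - 14\<close> is cancelled by many blocks of eight entries \<open>c\<close> and one entry \<open>-2 c\<close>. Each block
  has cube sum \<open>0\<close>, so both equations hold exactly, and the squares of the blocks tend to
  \<open>0\<close> as their number grows.
\<close>

section \<open>Sums of squares and cubes of numbers in the unit interval\<close>

text \<open>
  Counting the entries above \<open>1/2\<close> brings in the integrality. If there are at most \<open>k\<close> of
  them, their cubes sum to at most \<open>k\<close>, so the excess of the cube sum over \<open>k\<close> comes from
  entries \<open>v \<le> 1/2\<close>, for which \<open>v\<^sup>2 \<ge> 2 v\<^sup>3\<close>. If there are \<open>m \<ge> k + 1\<close> of them, their cubes fall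
  short of \<open>m\<close> by at least \<open>m - A\<close>, where \<open>A\<close> is the sum of all cubes, and for \<open>v \<ge> 1/2\<close> each
  shortfall \<open>1 - v\<^sup>3\<close> is at most \<open>7 (v\<^sup>2 - v\<^sup>3)\<close>; hence \<open>\<Sum>v\<^sup>2 \<ge> A + (m - A) / 7\<close>. This lower bound
  increases with \<open>A\<close>, and at \<open>A = B\<close> it suffices because \<open>B\<close> is no further from \<open>k\<close> than from \<open>k + 1\<close>.
\<close>

lemma sum_squares_ge_off_integer:
  fixes v :: "'a \<Rightarrow> real" and k :: nat
  assumes fin: "finite I" and v: "\<And>i. i \<in> I \<Longrightarrow> 0 \<le> v i \<and> v i \<le> 1"
    and B: "B \<le> (\<Sum>i\<in>I. v i ^ 3)" "real k \<le> B" "B \<le> real k + 1 / 2"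
  shows "B + (B - real k) / 7 \<le> (\<Sum>i\<in>I. (v i)\<^sup>2)"
proof -
  define b where "b i = (if v i > 1 / 2 then 1 else 0 :: real)" for i
  define A where "A = (\<Sum>i\<in>I. v i ^ 3)"
  define m where "m = card {i \<in> I. v i > 1 / 2}"
  have sum_b: "(\<Sum>i\<in>I. b i) = real m"
    unfolding b_def m_def using fin by (simp add: sum.If_cases Int_def)
  have small: "2 * v i ^ 3 - b i \<le> (v i)\<^sup>2" if "i \<in> I" for i
  proof (cases "v i > 1 / 2")
    case True
    have "v i ^ 3 \<le> (v i)\<^sup>2" "v i ^ 3 \<le> 1"
      using v[OF that] by (auto intro: power_decreasing power_le_one)
    then show ?thesis using True by (simp add: b_def)
  next
    case False
    have "(v i)\<^sup>2 * (2 * v i) \<le> (v i)\<^sup>2 * 1"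
      using False by (intro mult_left_mono) auto
    then show ?thesis using False by (simp add: b_def power2_eq_square power3_eq_cube)
  qed
  have big: "6 / 7 * v i ^ 3 + b i / 7 \<le> (v i)\<^sup>2" if "i \<in> I" for i
  proof (cases "v i > 1 / 2")
    case True
    have "0 \<le> (1 - v i) * ((3 * v i + 1) * (2 * v i - 1))"
      using True v[OF that] by (intro mult_nonneg_nonneg) auto
    then show ?thesis using True
      by (simp add: b_def power2_eq_square power3_eq_cube algebra_simps)
  next
    case False
    have "v i ^ 3 \<le> (v i)\<^sup>2" "b i = 0"
      using v[OF that] False by (auto simp: b_def intro: power_decreasing)
    then show ?thesis using zero_le_power2[of "v i"] by linarith
  qed
  have "(\<Sum>i\<in>I. 2 * v i ^ 3 - b i) \<le> (\<Sum>i\<in>I. (v i)\<^sup>2)"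
    by (rule sum_mono) (rule small)
  then have 1: "2 * A - real m \<le> (\<Sum>i\<in>I. (v i)\<^sup>2)"
    by (simp add: sum_subtractf sum_b A_def flip: sum_distrib_left)
  have "(\<Sum>i\<in>I. 6 / 7 * v i ^ 3 + b i / 7) \<le> (\<Sum>i\<in>I. (v i)\<^sup>2)"
    by (rule sum_mono) (rule big)
  then have 2: "6 / 7 * A + real m / 7 \<le> (\<Sum>i\<in>I. (v i)\<^sup>2)"
    by (simp only: sum.distrib sum_b A_def flip: sum_distrib_left sum_divide_distrib)
  have "m \<le> k \<or> real m \<ge> real k + 1" by linarith
  then show ?thesis
    using 1 2 B unfolding A_def[symmetric] by (auto simp: field_simps)
qed

section \<open>Optimality of the cube root of 14\<close>

text \<open>
  For \<open>M = t\<^sup>3\<close> the inequality becomes, after clearing denominators,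
  \<open>0 \<le> t (t - a) ((a - 1) t - (a + 1))\<close>, with equality at \<open>t = a\<close>. The second
  root \<open>(a + 1) / (a - 1)\<close> lies just above \<open>a\<close>, so this
  fails only for \<open>t\<^sup>3\<close> slightly larger than \<open>14\<close>; there the additional squares
  \<open>(t\<^sup>3 - 14) / 7\<close> make up for it.
\<close>

lemma ratio_le_at_cuberoot_14:
  fixes a t M :: real
  assumes a: "0 < a" "a ^ 3 = 14" and t: "1 \<le> t" and M: "t ^ 3 \<le> M"
    and M': "14 \<le> t ^ 3 \<Longrightarrow> t ^ 3 \<le> 14 + 1 / 2 \<Longrightarrow> t ^ 3 + (t ^ 3 - 14) / 7 \<le> M"
  shows "t * (t - 1) / (t\<^sup>2 + M) \<le> (a - 1) / (a * (a + 1))"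
proof -
  have a_lo: "241 / 100 < a"
    by (rule power_less_imp_less_base[of _ 3]) (use a in \<open>simp_all add: power3_eq_cube\<close>)
  have a_hi: "a < 2411 / 1000"
    by (rule power_less_imp_less_base[of _ 3]) (use a in \<open>simp_all add: power3_eq_cube\<close>)
  define q where "q = (a - 1) * t - (a + 1)"
  have factor: "(a - 1) * (t\<^sup>2 + t ^ 3) - t * (t - 1) * (a * (a + 1)) = t * ((t - a) * q)"
    unfolding q_def by (simp add: power2_eq_square power3_eq_cube algebra_simps)
  have sq_a: "-(1 / 50) \<le> (a - 1) * a - (a + 1)" "(a - 1) * a - (a + 1) < 0"
  proof -
    have "(a - 241 / 100) * (a + 41 / 100) \<ge> 0" "(2411 / 1000 - a) * (a + 411 / 1000) \<ge> 0"
      using a_lo a_hi by (intro mult_nonneg_nonneg; simp)+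
    then show "-(1 / 50) \<le> (a - 1) * a - (a + 1)" "(a - 1) * a - (a + 1) < 0"
      using a_lo a_hi by (simp_all add: algebra_simps)
  qed
  have key: "t * (t - 1) * (a * (a + 1)) \<le> (a - 1) * (t\<^sup>2 + M)"
  proof -
    have mono: ?thesis if "t * (t - 1) * (a * (a + 1)) \<le> (a - 1) * (t\<^sup>2 + N)" "N \<le> M" for N
      using that a_lo mult_left_mono[of "t\<^sup>2 + N" "t\<^sup>2 + M" "a - 1"] by linarith
    consider "t \<le> a" | "a < t" "t ^ 3 \<le> 14 + 1 / 2" | "a < t" "14 + 1 / 2 < t ^ 3" by linarith
    then show ?thesis
    proof cases
      case 1
      have "(a - 1) * t \<le> (a - 1) * a" using 1 a_lo by (intro mult_left_mono) auto
      then have "q \<le> 0" using sq_a unfolding q_def by linarith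
      then have "0 \<le> t * ((t - a) * q)"
        using 1 t by (intro mult_nonneg_nonneg mult_nonpos_nonpos) auto
      then show ?thesis using factor M by (intro mono[of "t ^ 3"]) linarith+
    next
      \<comment> \<open>The factor \<open>q\<close> is negative by at most \<open>1/50\<close>, whereas \<open>t\<^sup>3 - 14\<close> is \<open>t - a\<close> times a
        quantity of size about \<open>3 a\<^sup>2\<close>, so very crude estimates suffice.\<close>
      case 2
      have "14 \<le> t ^ 3" using power_mono[of a t 3] 2 a by simp
      then have N: "t ^ 3 + (t ^ 3 - 14) / 7 \<le> M" using M' 2 by blast
      have "(a - 1) * a \<le> (a - 1) * t" using 2 a_lo by (intro mult_left_mono) auto
      then have "-(1 / 50) \<le> q" using sq_a unfolding q_def by linarith
      then have "t * -(1 / 50) \<le> t * q" using t by (intro mult_left_mono) auto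
      moreover have "(7 / 5) * t \<le> (a - 1) * (t\<^sup>2 + t * a + a\<^sup>2)"
      proof (rule mult_mono)
        have "t * 1 \<le> t * a" using t a_lo by (intro mult_left_mono) auto
        then show "t \<le> t\<^sup>2 + t * a + a\<^sup>2" using zero_le_power2[of t] zero_le_power2[of a] by linarith
      qed (use a_lo t in auto)
      ultimately have "0 \<le> t * q + (a - 1) * (t\<^sup>2 + t * a + a\<^sup>2) / 7"
        using t by (simp add: field_simps)
      then have "0 \<le> (t - a) * (t * q + (a - 1) * (t\<^sup>2 + t * a + a\<^sup>2) / 7)"
        using 2 by (intro mult_nonneg_nonneg) auto
      also have "\<dots> = t * ((t - a) * q) + (a - 1) * ((t ^ 3 - a ^ 3) / 7)"
        by (simp add: power2_eq_square power3_eq_cube field_simps)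
      finally have "0 \<le> t * ((t - a) * q) + (a - 1) * ((t ^ 3 - 14) / 7)"
        using a by simp
      moreover have "(a - 1) * (t\<^sup>2 + (t ^ 3 + (t ^ 3 - 14) / 7))
          = (a - 1) * (t\<^sup>2 + t ^ 3) + (a - 1) * ((t ^ 3 - 14) / 7)"
        by (simp only: distrib_left add.assoc)
      ultimately show ?thesis using factor
        by (intro mono[OF _ N]) linarith
    next
      case 3
      \<comment> \<open>\<open>2.43\<close> separates \<open>(a + 1) / (a - 1)\<close>, about \<open>2.418\<close>, from the cube root of \<open>14.5\<close>.\<close>
      have "243 / 100 < t"
        by (rule power_less_imp_less_base[of _ 3]) (use 3 t in \<open>simp_all add: power3_eq_cube\<close>)
      then have "(a - 1) * (243 / 100) \<le> (a - 1) * t" using a_lo by (intro mult_left_mono) auto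
      moreover have "a + 1 \<le> (a - 1) * (243 / 100)" using a_lo by simp
      ultimately have "0 \<le> q" unfolding q_def by linarith
      then have "0 \<le> t * ((t - a) * q)"
        using 3 t by (intro mult_nonneg_nonneg) auto
      then show ?thesis using factor M by (intro mono[of "t ^ 3"]) linarith+
    qed
  qed
  have "0 < t\<^sup>2 + M" using M t zero_less_power[of t 3] zero_le_power2[of t] by linarith
  moreover have "0 < a * (a + 1)" using a_lo by simp
  ultimately show ?thesis
    using key by (simp only: pos_divide_le_eq pos_le_divide_eq times_divide_eq_left)
qed

section \<open>The upper bound\<close>

lemma feasible_value_le:
  fixes a :: real
  assumes a: "0 < a" "a ^ 3 = 14" and n: "n \<ge> 1" and f: "feasible n l"
  shows "(l 1 + l n) / real n \<le> (a - 1) / (a * (a + 1))"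
proof (cases "l 1 + l n \<le> 0")
  case True
  have "1 < a" by (rule power_less_imp_less_base[of _ 3]) (use a in simp_all)
  then have "0 \<le> (a - 1) / (a * (a + 1))" by simp
  moreover have "(l 1 + l n) / real n \<le> 0" using True by (simp add: divide_nonpos_nonneg)
  ultimately show ?thesis by linarith
next
  case False
  have upper: "l i \<le> l 1" and lower: "l n \<le> l i" if "i \<in> {1..n}" for i
    using f that n by (auto simp: feasible_def monotone_on_def)
  have sum1: "(\<Sum>i=1..n. l i) = 0" and sum3: "(\<Sum>i=1..n. l i ^ 3) = 0"
    and sum2: "(\<Sum>i=1..n. (l i)\<^sup>2) \<le> real n * l 1"
    using f by (auto simp: feasible_def)
  have pos: "0 < l 1" using False upper[of n] n by auto
  have neg: "l n < 0"
  proof (rule ccontr)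
    assume "\<not> l n < 0"
    then have nonneg: "0 \<le> l i" if "i \<in> {1..n}" for i using lower[OF that] by linarith
    have "l 1 \<le> (\<Sum>i=1..n. l i)" using n nonneg by (intro member_le_sum) auto
    then show False using sum1 pos by simp
  qed
  define y where "y = - l n"
  define t where "t = l 1 / y"
  define I where "I = {i \<in> {1..n}. l i < 0}"
  define v where "v i = - l i / y" for i
  define M where "M = (\<Sum>i\<in>I. (v i)\<^sup>2)"
  have y: "0 < y" using neg by (simp add: y_def)
  have l1: "l 1 = t * y" using y by (simp add: t_def)
  have lv: "l i = - (y * v i)" for i using y by (simp add: v_def)
  have t1: "1 \<le> t" using False y by (simp add: t_def le_divide_eq) (simp add: y_def)
  have v: "0 \<le> v i \<and> v i \<le> 1" if "i \<in> I" for i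
    using that lower[of i] y by (auto simp: I_def v_def y_def field_simps)
  have subset: "I \<subseteq> {1..n}" and fin: "finite I" and notin: "1 \<notin> I"
    using pos n by (auto simp: I_def)
  note split = sum.subset_diff[OF subset finite_atLeastAtMost]
  have "l 1 ^ 3 \<le> (\<Sum>i\<in>{1..n} - I. l i ^ 3)"
    using n notin by (intro member_le_sum) (auto simp: I_def)
  then have "l 1 ^ 3 + (\<Sum>i\<in>I. l i ^ 3) \<le> 0"
    using sum3 split[of "\<lambda>i. l i ^ 3"] by linarith
  moreover have "(\<Sum>i\<in>I. l i ^ 3) = - (y ^ 3 * (\<Sum>i\<in>I. v i ^ 3))"
    unfolding lv by (simp add: power_mult_distrib sum_distrib_left sum_negf)
  ultimately have "y ^ 3 * t ^ 3 \<le> y ^ 3 * (\<Sum>i\<in>I. v i ^ 3)"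
    unfolding l1 power_mult_distrib by (simp add: mult.commute)
  then have cubes: "t ^ 3 \<le> (\<Sum>i\<in>I. v i ^ 3)" using y by simp
  have "(\<Sum>i\<in>I. v i ^ 3) \<le> M"
    unfolding M_def using v by (intro sum_mono power_decreasing) auto
  then have M: "t ^ 3 \<le> M" using cubes by linarith
  have M': "t ^ 3 + (t ^ 3 - 14) / 7 \<le> M" if "14 \<le> t ^ 3" "t ^ 3 \<le> 14 + 1 / 2"
    using sum_squares_ge_off_integer[OF fin v cubes, of 14] that by (simp add: M_def)
  have "(l 1)\<^sup>2 \<le> (\<Sum>i\<in>{1..n} - I. (l i)\<^sup>2)"
    using n notin by (intro member_le_sum) auto
  then have "(l 1)\<^sup>2 + (\<Sum>i\<in>I. (l i)\<^sup>2) \<le> real n * l 1"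
    using sum2 split[of "\<lambda>i. (l i)\<^sup>2"] by linarith
  moreover have "(\<Sum>i\<in>I. (l i)\<^sup>2) = y\<^sup>2 * M"
    unfolding lv M_def by (simp add: power_mult_distrib sum_distrib_left)
  ultimately have "y * (y * (t\<^sup>2 + M)) \<le> y * (real n * t)"
    unfolding l1 by (simp add: power2_eq_square algebra_simps)
  then have "y * (t\<^sup>2 + M) \<le> real n * t" using y by simp
  then have "(t - 1) * (y * (t\<^sup>2 + M)) \<le> (t - 1) * (real n * t)"
    using t1 by (intro mult_left_mono) auto
  moreover have "0 < t\<^sup>2 + M" using M t1 zero_less_power[of t 3] zero_le_power2[of t] by linarith
  ultimately have "(t - 1) * y / real n \<le> t * (t - 1) / (t\<^sup>2 + M)"
    using n by (simp add: field_simps)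
  also have "\<dots> \<le> (a - 1) / (a * (a + 1))"
    by (rule ratio_le_at_cuberoot_14[OF a t1 M M'])
  also have "(t - 1) * y = l 1 + l n" using l1 by (simp add: y_def algebra_simps)
  finally show ?thesis .
qed

section \<open>A family of sequences attaining the bound in the limit\<close>

definition block_seq :: "real \<Rightarrow> nat \<Rightarrow> real \<Rightarrow> nat \<Rightarrow> real" where
  "block_seq a N c i =
     (if i \<le> 1 then a else if i \<le> 1 + 8 * N then c else if i \<le> 1 + 9 * N then - 2 * c else - 1)"

lemma sum_block_seq:
  fixes h :: "real \<Rightarrow> real"
  shows "(\<Sum>i=1..15 + 9 * N. h (block_seq a N c i))
    = h a + 8 * real N * h c + real N * h (- 2 * c) + 14 * h (- 1)"
proof -
  let ?g = "\<lambda>i. h (block_seq a N c i)"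
  have "sum ?g {1..15 + 9 * N} = sum ?g {1..1} + sum ?g {2..1 + 8 * N}
      + sum ?g {2 + 8 * N..1 + 9 * N} + sum ?g {2 + 9 * N..15 + 9 * N}"
  proof -
    have "{1..15 + 9 * N} = {1..1} \<union> {2..1 + 8 * N} \<union> {2 + 8 * N..1 + 9 * N} \<union> {2 + 9 * N..15 + 9 * N}"
      by auto
    then show ?thesis
      by (simp only:) (subst sum.union_disjoint; (simp add: disjoint_iff)?)+
  qed
  also have "sum ?g {2..1 + 8 * N} = (\<Sum>i\<in>{2..1 + 8 * N}. h c)"
    by (rule sum.cong) (auto simp: block_seq_def)
  also have "sum ?g {2 + 8 * N..1 + 9 * N} = (\<Sum>i\<in>{2 + 8 * N..1 + 9 * N}. h (- 2 * c))"
    by (rule sum.cong) (auto simp: block_seq_def)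
  also have "sum ?g {2 + 9 * N..15 + 9 * N} = (\<Sum>i\<in>{2 + 9 * N..15 + 9 * N}. h (- 1))"
    by (rule sum.cong) (auto simp: block_seq_def)
  finally show ?thesis by (simp add: block_seq_def)
qed

text \<open>
  Taking \<open>c = (14 - a) / (6 N)\<close> makes the \<open>N\<close> blocks, each of sum \<open>8 c - 2 c = 6 c\<close>, cancel \<open>a - 14\<close>; their squares
  contribute \<open>12 N c\<^sup>2 = (14 - a)\<^sup>2 / (3 N)\<close>. The equations for the sum and for the cube sum are homogeneous, so the
  sequence may be rescaled by the factor \<open>s\<close> that turns the quadratic condition into an equality.
\<close>

lemma block_seq_value:
  fixes a :: real
  assumes a: "0 < a" "a ^ 3 = 14" and N: "N \<ge> 5"
  shows "a * (a - 1) / (a\<^sup>2 + 14 + (14 - a)\<^sup>2 / (3 * real N)) \<in> gamma5'_values"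
proof -
  have a_lo: "1 < a" by (rule power_less_imp_less_base[of _ 3]) (use a in simp_all)
  have a_hi: "a < 3" by (rule power_less_imp_less_base[of _ 3]) (use a in simp_all)
  define c where "c = (14 - a) / (6 * real N)"
  define n where "n = 15 + 9 * N"
  define D where "D = a\<^sup>2 + 14 + (14 - a)\<^sup>2 / (3 * real N)"
  define s where "s = real n * a / D"
  define l where "l i = s * block_seq a N c i" for i
  have D: "0 < D" unfolding D_def by (rule add_pos_nonneg, rule add_nonneg_pos) auto
  have s: "0 < s" unfolding s_def n_def using a D by (intro divide_pos_pos mult_pos_pos) auto
  have c: "0 < c" "c \<le> 1 / 2"
    using a_lo a_hi N by (auto simp: c_def field_simps)
  have sum1: "(\<Sum>i=1..n. block_seq a N c i) = 0"
    using sum_block_seq[of "\<lambda>x. x" a N c] N by (simp add: n_def c_def field_simps)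
  have sum3: "(\<Sum>i=1..n. block_seq a N c i ^ 3) = 0"
    using sum_block_seq[of "\<lambda>x. x ^ 3" a N c] a by (simp add: n_def power_mult_distrib)
  have "12 * real N * c\<^sup>2 = (14 - a)\<^sup>2 / (3 * real N)"
    using N by (simp add: c_def power_divide power2_eq_square)
  then have sum2: "(\<Sum>i=1..n. (block_seq a N c i)\<^sup>2) = D"
    using sum_block_seq[of "\<lambda>x. x\<^sup>2" a N c] by (simp add: n_def D_def power_mult_distrib)
  have "antimono_on {1..n} l"
  proof (rule monotone_onI)
    fix i j assume "i \<in> {1..n}" "j \<in> {1..n}" "i \<le> j"
    then have "block_seq a N c j \<le> block_seq a N c i"
      using a_lo c by (auto simp: block_seq_def)
    then show "l j \<le> l i" using s by (simp add: l_def)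
  qed
  moreover have "(\<Sum>i=1..n. l i) = 0"
    using sum1 by (simp add: l_def flip: sum_distrib_left)
  moreover have "(\<Sum>i=1..n. l i ^ 3) = 0"
    using sum3 by (simp add: l_def power_mult_distrib flip: sum_distrib_left)
  moreover have "(\<Sum>i=1..n. (l i)\<^sup>2) \<le> real n * l 1"
  proof -
    have "(\<Sum>i=1..n. (l i)\<^sup>2) = s\<^sup>2 * D"
      using sum2 by (simp add: l_def power_mult_distrib flip: sum_distrib_left)
    also have "\<dots> = real n * l 1"
      using D by (simp add: l_def s_def block_seq_def power2_eq_square)
    finally show ?thesis by simp
  qed
  ultimately have "feasible n l" by (simp add: feasible_def)
  moreover have "a * (a - 1) / D = (l 1 + l n) / real n"
  proof -
    have "l 1 + l n = s * (a - 1)"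
      by (simp add: l_def block_seq_def n_def right_diff_distrib)
    then show ?thesis by (simp add: s_def n_def)
  qed
  moreover have "n \<ge> 1" by (simp add: n_def)
  ultimately show ?thesis unfolding gamma5'_values_def D_def by blast
qed

lemma block_seq_value_tendsto:
  fixes a :: real
  assumes a: "0 < a" "a ^ 3 = 14"
  shows "(\<lambda>N. a * (a - 1) / (a\<^sup>2 + 14 + (14 - a)\<^sup>2 / (3 * real N)))
    \<longlonglongrightarrow> (a - 1) / (a * (a + 1))"
proof -
  have "(\<lambda>N. (14 - a)\<^sup>2 / 3 * inverse (real N)) \<longlonglongrightarrow> (14 - a)\<^sup>2 / 3 * 0"
    by (intro tendsto_intros lim_inverse_n)
  then have "(\<lambda>N. (14 - a)\<^sup>2 / (3 * real N)) \<longlonglongrightarrow> 0"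
    by (simp add: field_simps)
  moreover have "a\<^sup>2 + 14 + 0 \<noteq> 0" using zero_le_power2[of a] by linarith
  ultimately have "(\<lambda>N. a * (a - 1) / (a\<^sup>2 + 14 + (14 - a)\<^sup>2 / (3 * real N)))
      \<longlonglongrightarrow> a * (a - 1) / (a\<^sup>2 + 14 + 0)"
    by (intro tendsto_intros)
  also have "a * (a - 1) / (a\<^sup>2 + 14 + 0) = (a - 1) / (a * (a + 1))"
  proof -
    have "a\<^sup>2 + 14 + 0 = a * (a * (a + 1))"
      using a(2) by (simp add: power2_eq_square power3_eq_cube algebra_simps)
    then show ?thesis using a(1) by simp
  qed
  finally show ?thesis .
qed

theorem theorem3p4:
  "gamma5' = (1 - 14 powr (- 1 / 3)) / (1 + 14 powr (1 / 3))"
proof -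
  define a :: real where "a = 14 powr (1 / 3)"
  have a: "0 < a" "a ^ 3 = 14"
    by (simp_all add: a_def powr_powr flip: powr_numeral)
  have "gamma5' = (a - 1) / (a * (a + 1))"
  proof (rule antisym)
    show "gamma5' \<le> (a - 1) / (a * (a + 1))"
      unfolding gamma5'_def
      using gamma5'_values_nonempty
      by (rule cSup_least) (auto simp: gamma5'_values_def simp del: One_nat_def intro: feasible_value_le[OF a])
    show "(a - 1) / (a * (a + 1)) \<le> gamma5'"
      unfolding gamma5'_def
      using block_seq_value[OF a] gamma5'_values_bdd_above
      by (intro LIMSEQ_le_const2[OF block_seq_value_tendsto[OF a]]) (blast intro: cSup_upper)
  qed
  also have "\<dots> = (1 - 1 / a) / (1 + a)"
    using a by (simp add: field_simps)
  also have "1 / a = 14 powr (- 1 / 3)"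
    by (simp add: a_def powr_minus_divide)
  finally show ?thesis unfolding a_def .
qed

end
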